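(* Let $0<c<d$. The random times $T^{\theta}_{-d,c}$, $T^{|\theta|}_{c}$ and $T^{\theta}_{c}$ satisfy $$T^{\theta}_{c}\ \ge\ T^{\theta}_{-d,c}\ \ge\ T^{|\theta|}_{c}.$$ Thus, for every $p>0$, their negative moments satisfy $$E\left[\frac{1}{(T^{\theta}_{c})^{p}}\right]\le E\left[\frac{1}{(T^{\theta}_{-d,c})^{p}}\right]\le E\left[\frac{1}{(T^{|\theta|}_{c})^{p}}\right]<\infty .$$
   Context: Let $(Z_t=X_t+\mathrm{i}Y_t,\ t\ge 0)$ be a standard planar Brownian motion starting from $1+\mathrm{i}0$, where $(X_t)$ and $(Y_t)$ are independent real-valued Brownian motions starting from $1$ and $0$ respectively. Almost surely $Z$ never visits $0$, and the continuous winding process around $0$ is $\theta_t=\operatorname{Im}\big(\int_0^t \frac{\mathrm{d}Z_s}{Z_s}\big)$, $t\ge 0$, so that $\theta_0=0$ and $\theta_t$ is the continuous determination of the argument of $Z_t$. For $c,d>0$ set $T^{|\theta|}_{c}=\inf\{t\ge 0:\ |\theta_t|=c\}$, $T^{\theta}_{c}=\inf\{t\ge 0:\ \theta_t=c\}$ and $T^{\theta}_{-d,c}=\inf\{t\ge 0:\ \theta_t\notin(-d,c)\}$. *)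

theory Defs
  imports "HOL-Probability.Probability"
begin

(* Processes are indexed by all reals; only their values at times t >= 0 matter. *)

definition brownian_motion :: "'a measure \<Rightarrow> (real \<Rightarrow> 'a \<Rightarrow> real) \<Rightarrow> real \<Rightarrow> bool" where
  "brownian_motion M B x \<longleftrightarrow>
     (\<forall>t\<ge>0. B t \<in> borel_measurable M) \<and>
     (AE \<omega> in M. B 0 \<omega> = x) \<and>
     (\<forall>n (t :: nat \<Rightarrow> real). 0 \<le> t 0 \<and> (\<forall>i<n. t i \<le> t (Suc i)) \<longrightarrow>
        prob_space.indep_vars M (\<lambda>_. borel) (\<lambda>i \<omega>. B (t (Suc i)) \<omega> - B (t i) \<omega>) {..<n}) \<and>
     (\<forall>s t. 0 \<le> s \<and> s < t \<longrightarrow>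
        distributed M lborel (\<lambda>\<omega>. B t \<omega> - B s \<omega>) (normal_density 0 (sqrt (t - s)))) \<and>
     (AE \<omega> in M. continuous_on {0..} (\<lambda>t. B t \<omega>))"

(* The two coordinates are independent as whole processes, i.e. as random elements of the
   product space of real functions on [0, \<infinity>). *)

definition planar_brownian_motion ::
    "'a measure \<Rightarrow> (real \<Rightarrow> 'a \<Rightarrow> complex) \<Rightarrow> complex \<Rightarrow> bool" where
  "planar_brownian_motion M Z z \<longleftrightarrow>
     brownian_motion M (\<lambda>t \<omega>. Re (Z t \<omega>)) (Re z) \<and>
     brownian_motion M (\<lambda>t \<omega>. Im (Z t \<omega>)) (Im z) \<and>
     prob_space.indep_var M
       (Pi\<^sub>M {0..} (\<lambda>_. borel)) (\<lambda>\<omega>. \<lambda>t\<in>{0..}. Re (Z t \<omega>))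
       (Pi\<^sub>M {0..} (\<lambda>_. borel)) (\<lambda>\<omega>. \<lambda>t\<in>{0..}. Im (Z t \<omega>))"

definition partition_mesh_less :: "(nat \<Rightarrow> real) \<Rightarrow> nat \<Rightarrow> real \<Rightarrow> real \<Rightarrow> bool" where
  "partition_mesh_less \<tau> N t \<delta> \<longleftrightarrow>
     \<tau> 0 = 0 \<and> \<tau> N = t \<and> (\<forall>i<N. \<tau> i \<le> \<tau> (Suc i) \<and> \<tau> (Suc i) - \<tau> i < \<delta>)"

definition ito_sum ::
    "(real \<Rightarrow> 'a \<Rightarrow> complex) \<Rightarrow> (real \<Rightarrow> 'a \<Rightarrow> complex) \<Rightarrow> (nat \<Rightarrow> real) \<Rightarrow> nat \<Rightarrow> 'a \<Rightarrow> complex" where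
  "ito_sum H Z \<tau> N \<omega> = (\<Sum>i<N. H (\<tau> i) \<omega> * (Z (\<tau> (Suc i)) \<omega> - Z (\<tau> i) \<omega>))"

(* I is the continuous version of the Ito integral process \<integral>_0^t H_s dZ_s: at each time t, I_t is
   the limit in probability, as the mesh of the partition of [0,t] tends to 0, of the sums
   with the integrand evaluated at left endpoints. This is the Ito integral for integrands H
   that are adapted with almost surely continuous paths. *)

definition ito_integral_process ::
    "'a measure \<Rightarrow> (real \<Rightarrow> 'a \<Rightarrow> complex) \<Rightarrow> (real \<Rightarrow> 'a \<Rightarrow> complex) \<Rightarrow> (real \<Rightarrow> 'a \<Rightarrow> complex) \<Rightarrow> bool" where
  "ito_integral_process M H Z I \<longleftrightarrow>
     (\<forall>t\<ge>0. I t \<in> borel_measurable M) \<and>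
     (AE \<omega> in M. continuous_on {0..} (\<lambda>t. I t \<omega>)) \<and>
     (\<forall>t\<ge>0. \<forall>\<epsilon>>0. \<forall>\<eta>>0. \<exists>\<delta>>0. \<forall>\<tau> N. partition_mesh_less \<tau> N t \<delta> \<longrightarrow>
        measure M {\<omega> \<in> space M. \<epsilon> < norm (ito_sum H Z \<tau> N \<omega> - I t \<omega>)} < \<eta>)"

definition winding_process ::
    "'a measure \<Rightarrow> (real \<Rightarrow> 'a \<Rightarrow> complex) \<Rightarrow> (real \<Rightarrow> 'a \<Rightarrow> real) \<Rightarrow> bool" where
  "winding_process M Z \<theta> \<longleftrightarrow>
     (\<exists>I. ito_integral_process M (\<lambda>t \<omega>. 1 / Z t \<omega>) Z I \<and> \<theta> = (\<lambda>t \<omega>. Im (I t \<omega>)))"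

(* Hitting times take values in [0, \<infinity>]; the infimum of the empty set is \<infinity>. *)

definition hitting_time :: "(real \<Rightarrow> 'a \<Rightarrow> real) \<Rightarrow> real set \<Rightarrow> 'a \<Rightarrow> ennreal" where
  "hitting_time B A \<omega> = (INF t\<in>{t. 0 \<le> t \<and> B t \<omega> \<in> A}. ennreal t)"

definition T_abs :: "(real \<Rightarrow> 'a \<Rightarrow> real) \<Rightarrow> real \<Rightarrow> 'a \<Rightarrow> ennreal" where
  "T_abs \<theta> c = hitting_time (\<lambda>t \<omega>. \<bar>\<theta> t \<omega>\<bar>) {c}"

definition T_one :: "(real \<Rightarrow> 'a \<Rightarrow> real) \<Rightarrow> real \<Rightarrow> 'a \<Rightarrow> ennreal" where
  "T_one \<theta> c = hitting_time \<theta> {c}"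

definition T_exit :: "(real \<Rightarrow> 'a \<Rightarrow> real) \<Rightarrow> real \<Rightarrow> real \<Rightarrow> 'a \<Rightarrow> ennreal" where
  "T_exit \<theta> d c = hitting_time \<theta> (- {- d<..<c})"

(* 1 / T^p with values in [0, \<infinity>]; the values at 0 and \<infinity> are set explicitly because
   powr and division on the reals would give 1 / 0 powr p = 0. *)

definition inverse_powr :: "ennreal \<Rightarrow> real \<Rightarrow> ennreal" where
  "inverse_powr T p =
     (if T = 0 then \<infinity> else if T = \<infinity> then 0 else ennreal (1 / enn2real T powr p))"

end

theory Submission
  imports Defs "HOL-Real_Asymp.Real_Asymp"
begin

text \<open>The order of the three hitting times is a pathwise matter: almost every path of \<open>\<theta>\<close> is continuous
  and starts at 0, the level \<open>c\<close> lies outside \<open>(- d, c)\<close>, and a path that has left \<open>(- d, c)\<close> has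
  passed through \<open>\<bar>\<theta>\<bar> = c\<close> since \<open>c < d\<close>. As \<open>1 / T\<^sup>p\<close> decreases in \<open>T\<close>, the negative moments are
  ordered the other way round. What remains is that the largest one is finite, and for this it
  suffices that \<open>\<bar>\<theta>\<bar>\<close> reaches \<open>c\<close> before time \<open>t\<close> with probability at most \<open>3 exp (- \<kappa> / t)\<close>, for
  some \<open>\<kappa> > 0\<close> (lemmas \<open>winding_tail\<close> and \<open>nn_integral_inverse_powr_finite\<close>).

  The reason for this bound is that \<open>\<theta>\<close> is a stochastic integral against Brownian motion whose
  integrand \<open>1 / Z\<close> is bounded by 2 as long as \<open>Re Z > 1 / 2\<close>, and that \<open>Re Z\<close> itself is unlikely to
  fall from 1 to \<open>1 / 2\<close> within a short time. This is made precise in discrete time. On a uniform grid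
  of \<open>[0, t]\<close> the increments of \<open>Z\<close> are independent Gaussian variables, and an Ito sum with a
  predictable integrand that is bounded by \<open>b\<close> has exponential moments of at most
  \<open>exp (b\<^sup>2 t / 2)\<close>: conditioning on the past removes one increment after the other
  (\<open>nn_integral_exp_predictable_sum\<close>). This applies to the Ito sums of the winding stopped when
  \<open>Re Z \<le> 1 / 2\<close> or when they reach a given size in absolute value, and likewise to the stopped
  \<open>Re Z\<close>. If stopping occurs at all, then one of these stopped sums is large at the end, and
  Markov's inequality gives the bound (\<open>emeasure_dead_le\<close>).

  The bound is uniform in the grid. Since the Ito sums converge to the integral in probability at
  each time, it carries over to the values of \<open>\<theta>\<close> at finitely many dyadic times
  (\<open>winding_tail_grid\<close>), and by continuity of the paths to all times before \<open>t\<close>.\<close>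

section \<open>Exponential moments of predictable Gaussian sums\<close>

text \<open>Completing the square turns \<open>exp (a u)\<close> times the density into a multiple of the density of
  the shifted normal law with mean \<open>a s\<^sup>2\<close>.\<close>

lemma nn_integral_exp_normal_density:
  assumes s: "s > 0"
  shows "(\<integral>\<^sup>+u. ennreal (exp (a * u)) \<partial>density lborel (normal_density 0 s)) = ennreal (exp (a\<^sup>2 * s\<^sup>2 / 2))"
proof -
  have eq: "normal_density 0 s u * exp (a * u) = exp (a\<^sup>2 * s\<^sup>2 / 2) * normal_density (a * s\<^sup>2) s u" for u
  proof -
    have "- u\<^sup>2 / (2 * s\<^sup>2) + a * u = a\<^sup>2 * s\<^sup>2 / 2 + - (u - a * s\<^sup>2)\<^sup>2 / (2 * s\<^sup>2)"
      using s by (simp add: field_simps power2_eq_square)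
    hence "exp (- u\<^sup>2 / (2 * s\<^sup>2)) * exp (a * u) = exp (a\<^sup>2 * s\<^sup>2 / 2) * exp (- (u - a * s\<^sup>2)\<^sup>2 / (2 * s\<^sup>2))"
      by (simp only: exp_add[symmetric])
    thus ?thesis by (simp add: normal_density_def)
  qed
  have "(\<integral>\<^sup>+u. ennreal (exp (a * u)) \<partial>density lborel (normal_density 0 s))
      = (\<integral>\<^sup>+u. ennreal (exp (a\<^sup>2 * s\<^sup>2 / 2)) * ennreal (normal_density (a * s\<^sup>2) s u) \<partial>lborel)"
    by (subst nn_integral_density) (simp_all add: eq ennreal_mult'[symmetric])
  also have "\<dots> = ennreal (exp (a\<^sup>2 * s\<^sup>2 / 2)) * (\<integral>\<^sup>+u. ennreal (normal_density (a * s\<^sup>2) s u) \<partial>lborel)"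
    by (rule nn_integral_cmult) simp
  also have "(\<integral>\<^sup>+u. ennreal (normal_density (a * s\<^sup>2) s u) \<partial>lborel) = 1"
    using s by (simp add: nn_integral_eq_integral)
  finally show ?thesis by simp
qed

abbreviation real_seqs :: "nat \<Rightarrow> (nat \<Rightarrow> real) measure" where
  "real_seqs n \<equiv> Pi\<^sub>M {..<n} (\<lambda>_. borel)"

abbreviation gauss_seqs :: "real \<Rightarrow> nat \<Rightarrow> (nat \<Rightarrow> real) measure" where
  "gauss_seqs s n \<equiv> Pi\<^sub>M {..<n} (\<lambda>_. density lborel (normal_density 0 s))"

text \<open>The increments of the two coordinates up to the last grid time are kept as two separate
  sequences, and a coefficient is a function of the whole pair which may look only at entries
  before its own index. The function is thus the same for all lengths of the sequences, which
  allows induction on the length; measurability has to be asked for every length that contains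
  the relevant entries.\<close>

definition predictable :: "(nat \<Rightarrow> (nat \<Rightarrow> real) \<Rightarrow> (nat \<Rightarrow> real) \<Rightarrow> real) \<Rightarrow> bool" where
  "predictable a \<longleftrightarrow>
     (\<forall>i x y x' y'. (\<forall>j<i. x j = x' j \<and> y j = y' j) \<longrightarrow> a i x y = a i x' y') \<and>
     (\<forall>n i. i \<le> n \<longrightarrow> (\<lambda>(x, y). a i x y) \<in> borel_measurable (real_seqs n \<Otimes>\<^sub>M real_seqs n))"

lemma predictable_cong:
  "predictable a \<Longrightarrow> (\<And>j. j < i \<Longrightarrow> x j = x' j \<and> y j = y' j) \<Longrightarrow> a i x y = a i x' y'"
  unfolding predictable_def by blast

lemma predictable_measurable:
  "predictable a \<Longrightarrow> i \<le> n \<Longrightarrow>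
     (\<lambda>(x, y). a i x y) \<in> borel_measurable (real_seqs n \<Otimes>\<^sub>M real_seqs n)"
  unfolding predictable_def by blast

text \<open>This is the estimate for the exponential supermartingale of a stochastic integral in discrete
  time: given the past, the last summand is Gaussian with variance at most \<open>K s\<^sup>2\<close>, so that
  integrating out the last increment of each coordinate costs a factor at most
  \<open>exp (K s\<^sup>2 / 2)\<close>.\<close>

lemma nn_integral_exp_predictable_sum:
  assumes s: "s > 0" and a: "predictable a" and b: "predictable b"
    and K: "\<And>i x y. (a i x y)\<^sup>2 + (b i x y)\<^sup>2 \<le> K"
  shows "(\<integral>\<^sup>+x. \<integral>\<^sup>+y. ennreal (exp (\<Sum>i<n. a i x y * x i + b i x y * y i)) \<partial>gauss_seqs s n \<partial>gauss_seqs s n)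
      \<le> ennreal (exp (K * s\<^sup>2 * n / 2))"
proof (induction n)
  case 0
  interpret prob_space "gauss_seqs s 0"
    by (rule prob_space_PiM) (rule prob_space_normal_density[OF s])
  show ?case using emeasure_space_1 by simp
next
  case (Suc n)
  define G where "G = density lborel (\<lambda>x. ennreal (normal_density 0 s x))"
  have sets_G [measurable_cong, simp]: "sets G = sets borel" by (simp add: G_def)
  interpret G: prob_space G unfolding G_def by (rule prob_space_normal_density[OF s])
  interpret P: product_prob_space "\<lambda>_::nat. G" by unfold_locales
  define P where "P = (\<lambda>n::nat. Pi\<^sub>M {..<n} (\<lambda>_. G))"
  have sets_P [measurable_cong]: "sets (P n) = sets (real_seqs n)" for n
    unfolding P_def by (rule sets_PiM_cong) simp_all
  have spP: "prob_space (P n)" for n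
    unfolding P_def by (rule prob_space_PiM) unfold_locales
  interpret Pn: prob_space "P n" by (rule spP)
  interpret Pn': prob_space "P (Suc n)" by (rule spP)
  interpret GP: pair_sigma_finite G "P n" ..
  have insert: "integral\<^sup>N (P (Suc n)) f = (\<integral>\<^sup>+x. \<integral>\<^sup>+u. f (x(n := u)) \<partial>G \<partial>P n)"
    if f: "f \<in> borel_measurable (P (Suc n))" for f
    using P.product_nn_integral_insert[of "{..<n}" n f] f by (simp add: P_def lessThan_Suc)
  define E where "E = (\<lambda>n x y. exp (\<Sum>i<n. a i x y * x i + b i x y * y i))"
  have E_nonneg [simp]: "0 \<le> E k x y" for k x y
    by (simp add: E_def)
  have ab_meas: "(\<lambda>(x, y). a i x y) \<in> borel_measurable (P k \<Otimes>\<^sub>M P k)"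
       "(\<lambda>(x, y). b i x y) \<in> borel_measurable (P k \<Otimes>\<^sub>M P k)" if "i \<le> k" for i k
    using predictable_measurable[OF a that] predictable_measurable[OF b that]
      sets_pair_measure_cong[OF sets_P[of k] sets_P[of k]]
    by (simp_all cong: measurable_cong_sets)
  note [measurable] = ab_meas[of n n, OF order_refl]
  have comp: "(\<lambda>x. x i) \<in> borel_measurable (P k)" if "i < k" for i k
    using measurable_component_singleton[of i "{..<k}" "\<lambda>_. G"] that
    by (simp add: P_def cong: measurable_cong_sets)
  have E_meas [measurable]: "(\<lambda>(x, y). E k x y) \<in> borel_measurable (P k \<Otimes>\<^sub>M P k)" for k
  proof -
    have "(\<lambda>p. a i (fst p) (snd p) * fst p i + b i (fst p) (snd p) * snd p i)
        \<in> borel_measurable (P k \<Otimes>\<^sub>M P k)" if "i < k" for i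
      using comp[OF that] ab_meas[of i k] that by (simp add: split_beta')
    thus ?thesis
      unfolding E_def split_beta' by (intro measurable_compose[OF _ borel_measurable_exp] borel_measurable_sum) auto
  qed
  have upd [measurable]: "(\<lambda>u. x(n := u)) \<in> measurable G (P (Suc n))" if "x \<in> space (P n)" for x
  proof -
    have "(\<lambda>u. (\<lambda>(f, y). f(n := y)) (x, u)) \<in> measurable G (Pi\<^sub>M (insert n {..<n}) (\<lambda>_. G))"
      using that unfolding P_def by measurable
    thus ?thesis by (simp add: P_def lessThan_Suc)
  qed
  have E_upd: "E (Suc n) (x(n := u)) (y(n := w)) = E n x y * exp (a n x y * u) * exp (b n x y * w)"
    for x y u w
  proof -
    have "a i (x(n := u)) (y(n := w)) = a i x y" "b i (x(n := u)) (y(n := w)) = b i x y" if "i \<le> n" for i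
      using that by (auto intro!: predictable_cong[OF a] predictable_cong[OF b])
    thus ?thesis by (simp add: E_def exp_add)
  qed
  \<comment> \<open>Split off the last entries \<open>u\<close> of \<open>x\<close> and \<open>w\<close> of \<open>y\<close>, and move both integrals inside, where
    \<open>x\<close> and \<open>y\<close> are the past and the coefficients are constants.\<close>
  have "(\<integral>\<^sup>+x. \<integral>\<^sup>+y. ennreal (E (Suc n) x y) \<partial>P (Suc n) \<partial>P (Suc n))
      = (\<integral>\<^sup>+x. \<integral>\<^sup>+u. \<integral>\<^sup>+y. E (Suc n) (x(n := u)) y \<partial>P (Suc n) \<partial>G \<partial>P n)"
    by (subst insert) simp_all
  also have "\<dots> = (\<integral>\<^sup>+x. \<integral>\<^sup>+u. \<integral>\<^sup>+y. \<integral>\<^sup>+w. E (Suc n) (x(n := u)) (y(n := w)) \<partial>G \<partial>P n \<partial>G \<partial>P n)"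
  proof (intro nn_integral_cong insert)
    fix x u assume "x \<in> space (P n)" "u \<in> space G"
    hence [measurable]: "x(n := u) \<in> space (P (Suc n))"
      using upd[THEN measurable_space] by blast
    show "(\<lambda>y. ennreal (E (Suc n) (x(n := u)) y)) \<in> borel_measurable (P (Suc n))"
      by measurable
  qed
  also have "\<dots> = (\<integral>\<^sup>+x. \<integral>\<^sup>+u. \<integral>\<^sup>+y. ennreal (E n x y) * exp ((b n x y)\<^sup>2 * s\<^sup>2 / 2) * exp (a n x y * u) \<partial>P n \<partial>G \<partial>P n)"
  proof (intro nn_integral_cong)
    fix x u y
    have "(\<integral>\<^sup>+w. E (Suc n) (x(n := u)) (y(n := w)) \<partial>G) =
       (\<integral>\<^sup>+w. ennreal (E n x y * exp (a n x y * u)) * ennreal (exp (b n x y * w)) \<partial>G)"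
      by (intro nn_integral_cong) (simp add: E_upd ennreal_mult'[symmetric])
    also have "\<dots> = ennreal (E n x y * exp (a n x y * u)) * exp ((b n x y)\<^sup>2 * s\<^sup>2 / 2)"
      by (subst nn_integral_cmult)
         (simp_all add: nn_integral_exp_normal_density[OF s, folded G_def])
    also have "\<dots> = ennreal (E n x y) * exp ((b n x y)\<^sup>2 * s\<^sup>2 / 2) * exp (a n x y * u)"
      by (simp add: ennreal_mult'[symmetric] mult_ac)
    finally show "(\<integral>\<^sup>+w. E (Suc n) (x(n := u)) (y(n := w)) \<partial>G) =
      ennreal (E n x y) * exp ((b n x y)\<^sup>2 * s\<^sup>2 / 2) * exp (a n x y * u)" .
  qed
  also have "\<dots> = (\<integral>\<^sup>+x. \<integral>\<^sup>+y. \<integral>\<^sup>+u. ennreal (E n x y) * exp ((b n x y)\<^sup>2 * s\<^sup>2 / 2) * exp (a n x y * u) \<partial>G \<partial>P n \<partial>P n)"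
  proof (intro nn_integral_cong GP.Fubini'[symmetric])
    fix x assume [measurable]: "x \<in> space (P n)"
    show "(\<lambda>(u, y). ennreal (E n x y) * exp ((b n x y)\<^sup>2 * s\<^sup>2 / 2) * exp (a n x y * u))
      \<in> borel_measurable (G \<Otimes>\<^sub>M P n)"
      by measurable
  qed
  also have "\<dots> \<le> (\<integral>\<^sup>+x. \<integral>\<^sup>+y. ennreal (exp (K * s\<^sup>2 / 2)) * ennreal (E n x y) \<partial>P n \<partial>P n)"
  proof (intro nn_integral_mono)
    fix x y
    have "(\<integral>\<^sup>+u. ennreal (E n x y) * exp ((b n x y)\<^sup>2 * s\<^sup>2 / 2) * exp (a n x y * u) \<partial>G)
      = ennreal (E n x y) * exp ((b n x y)\<^sup>2 * s\<^sup>2 / 2) * exp ((a n x y)\<^sup>2 * s\<^sup>2 / 2)"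
      by (subst nn_integral_cmult)
         (simp_all add: nn_integral_exp_normal_density[OF s, folded G_def])
    also have "\<dots> = ennreal (E n x y) * exp (((a n x y)\<^sup>2 + (b n x y)\<^sup>2) * s\<^sup>2 / 2)"
      by (simp add: ennreal_mult'[symmetric] exp_add[symmetric] algebra_simps add_divide_distrib)
    also have "\<dots> \<le> ennreal (E n x y) * exp (K * s\<^sup>2 / 2)"
      using K[of n x y] by (intro mult_left_mono ennreal_leI) (auto intro!: mult_right_mono)
    finally show "(\<integral>\<^sup>+u. ennreal (E n x y) * exp ((b n x y)\<^sup>2 * s\<^sup>2 / 2) * exp (a n x y * u) \<partial>G)
       \<le> ennreal (exp (K * s\<^sup>2 / 2)) * ennreal (E n x y)" by (simp add: mult.commute)
  qed
  also have "\<dots> = (\<integral>\<^sup>+x. ennreal (exp (K * s\<^sup>2 / 2)) * (\<integral>\<^sup>+y. ennreal (E n x y) \<partial>P n) \<partial>P n)"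
    by (intro nn_integral_cong nn_integral_cmult) measurable
  also have "\<dots> = ennreal (exp (K * s\<^sup>2 / 2)) * (\<integral>\<^sup>+x. \<integral>\<^sup>+y. ennreal (E n x y) \<partial>P n \<partial>P n)"
    by (rule nn_integral_cmult) measurable
  also have "\<dots> \<le> ennreal (exp (K * s\<^sup>2 / 2)) * ennreal (exp (K * s\<^sup>2 * n / 2))"
    using Suc.IH by (intro mult_left_mono) (simp_all add: E_def P_def G_def)
  also have "\<dots> = ennreal (exp (K * s\<^sup>2 * Suc n / 2))"
    by (simp add: ennreal_mult'[symmetric] exp_add[symmetric] algebra_simps add_divide_distrib)
  finally show ?case by (simp add: E_def P_def G_def)
qed

section \<open>The walk stopped near the origin or at a large winding\<close>

definition walk :: "(nat \<Rightarrow> real) \<Rightarrow> (nat \<Rightarrow> real) \<Rightarrow> nat \<Rightarrow> complex" where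
  "walk x y k = 1 + (\<Sum>i<k. Complex (x i) (y i))"

definition walk_winding :: "(nat \<Rightarrow> real) \<Rightarrow> (nat \<Rightarrow> real) \<Rightarrow> nat \<Rightarrow> real" where
  "walk_winding x y k = (\<Sum>i<k. Im (1 / walk x y i * Complex (x i) (y i)))"

text \<open>Stopping at both events at once has two effects: up to the stopping time the coefficients
  \<open>1 / z\<close> are bounded by 2, and the value of the stopped sums at the final time tells whether
  stopping has occurred. Bounds for sums at a fixed time thus control the whole path.\<close>

definition alive :: "real \<Rightarrow> (nat \<Rightarrow> real) \<Rightarrow> (nat \<Rightarrow> real) \<Rightarrow> nat \<Rightarrow> bool" where
  "alive c x y k \<longleftrightarrow> (\<forall>j\<in>{..k}. 1 / 2 < Re (walk x y j) \<and> \<bar>walk_winding x y j\<bar> < c)"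

lemma walk_cong: "(\<And>j. j < k \<Longrightarrow> x j = x' j \<and> y j = y' j) \<Longrightarrow> walk x y k = walk x' y' k"
  unfolding walk_def by (intro arg_cong2[of _ _ _ _ "(+)"] sum.cong) auto

lemma walk_winding_cong:
  "(\<And>j. j < k \<Longrightarrow> x j = x' j \<and> y j = y' j) \<Longrightarrow> walk_winding x y k = walk_winding x' y' k"
  unfolding walk_winding_def
proof (intro sum.cong refl)
  fix i assume *: "\<And>j. j < k \<Longrightarrow> x j = x' j \<and> y j = y' j" and i: "i \<in> {..<k}"
  have "walk x y i = walk x' y' i"
    using * i by (intro walk_cong) auto
  thus "Im (1 / walk x y i * Complex (x i) (y i)) = Im (1 / walk x' y' i * Complex (x' i) (y' i))"
    using * i by auto
qed

lemma alive_cong: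
  assumes "\<And>j. j < k \<Longrightarrow> x j = x' j \<and> y j = y' j"
  shows "alive c x y k = alive c x' y' k"
proof -
  have "walk x y j = walk x' y' j" "walk_winding x y j = walk_winding x' y' j" if "j \<le> k" for j
    using assms that by (auto intro!: walk_cong walk_winding_cong)
  thus ?thesis by (simp add: alive_def)
qed

lemma measurable_walk:
  assumes "k \<le> n"
  shows "(\<lambda>p. walk (fst p) (snd p) k) \<in> borel_measurable (real_seqs n \<Otimes>\<^sub>M real_seqs n)"
proof -
  have "(\<lambda>p. Complex (fst p i) (snd p i)) \<in> borel_measurable (real_seqs n \<Otimes>\<^sub>M real_seqs n)" if "i < k" for i
  proof -
    have [measurable]: "(\<lambda>x. x i) \<in> borel_measurable (real_seqs n)"
      using that assms by (intro measurable_component_singleton) auto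
    show ?thesis by (simp add: Complex_eq)
  qed
  thus ?thesis unfolding walk_def by (intro borel_measurable_add borel_measurable_sum) auto
qed

lemma measurable_walk_winding:
  assumes "k \<le> n"
  shows "(\<lambda>p. walk_winding (fst p) (snd p) k) \<in> borel_measurable (real_seqs n \<Otimes>\<^sub>M real_seqs n)"
proof -
  have "(\<lambda>p. Im (1 / walk (fst p) (snd p) i * Complex (fst p i) (snd p i)))
      \<in> borel_measurable (real_seqs n \<Otimes>\<^sub>M real_seqs n)" if "i < k" for i
  proof -
    have [measurable]: "(\<lambda>x. x i) \<in> borel_measurable (real_seqs n)"
      using that assms by (intro measurable_component_singleton) auto
    note [measurable] = measurable_walk[of i n]
    have "i \<le> n" using that assms by simp
    thus ?thesis by (simp add: Complex_eq)
  qed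
  thus ?thesis unfolding walk_winding_def by (intro borel_measurable_sum) auto
qed

lemma measurable_alive:
  assumes "k \<le> n"
  shows "Measurable.pred (real_seqs n \<Otimes>\<^sub>M real_seqs n) (\<lambda>p. alive c (fst p) (snd p) k)"
  unfolding alive_def
proof (rule pred_intros_finite)
  fix j assume "j \<in> {..k}"
  hence j: "j \<le> n" using assms by simp
  note [measurable] = measurable_walk[OF j] measurable_walk_winding[OF j]
  show "Measurable.pred (real_seqs n \<Otimes>\<^sub>M real_seqs n)
      (\<lambda>p. 1 / 2 < Re (walk (fst p) (snd p) j) \<and> \<bar>walk_winding (fst p) (snd p) j\<bar> < c)"
    by measurable
qed simp

lemma predictable_stopped:
  assumes [measurable]: "f \<in> borel_measurable borel"
  shows "predictable (\<lambda>i x y. if alive c x y i then f (walk x y i) else 0)"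
  unfolding predictable_def
proof (intro conjI allI impI)
  fix i :: nat and x y x' y' :: "nat \<Rightarrow> real" assume *: "\<forall>j<i. x j = x' j \<and> y j = y' j"
  show "(if alive c x y i then f (walk x y i) else 0) = (if alive c x' y' i then f (walk x' y' i) else 0)"
    using alive_cong[of i x x' y y' c] walk_cong[of i x x' y y'] * by simp
next
  fix n i :: nat assume "i \<le> n"
  note [measurable] = measurable_walk[OF this] measurable_alive[OF this]
  show "(\<lambda>(x, y). if alive c x y i then f (walk x y i) else 0)
    \<in> borel_measurable (real_seqs n \<Otimes>\<^sub>M real_seqs n)"
    unfolding split_beta' by measurable
qed

text \<open>Taking imaginary parts covers all three sums that are needed: \<open>h z = l / z\<close> and its negative
  give the winding, and the constant \<open>h z = - \<i> l\<close> gives the displacement of the real part to the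
  left.\<close>

definition stopped_sum ::
    "real \<Rightarrow> (complex \<Rightarrow> complex) \<Rightarrow> (nat \<Rightarrow> real) \<Rightarrow> (nat \<Rightarrow> real) \<Rightarrow> nat \<Rightarrow> real" where
  "stopped_sum c h x y n = (\<Sum>i<n. if alive c x y i then Im (h (walk x y i) * Complex (x i) (y i)) else 0)"

text \<open>The increments of the two coordinates enter with the coefficients \<open>Im (h z)\<close> and \<open>Re (h z)\<close>, whose
  squares add up to \<open>\<bar>h z\<bar>\<^sup>2\<close>.\<close>

lemma nn_integral_exp_stopped_sum:
  assumes s: "s > 0" and [measurable]: "h \<in> borel_measurable borel"
    and h: "\<And>z. 1 / 2 < Re z \<Longrightarrow> norm (h z) \<le> b"
  shows "(\<integral>\<^sup>+x. \<integral>\<^sup>+y. ennreal (exp (stopped_sum c h x y n)) \<partial>gauss_seqs s n \<partial>gauss_seqs s n)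
      \<le> ennreal (exp (b\<^sup>2 * s\<^sup>2 * n / 2))"
proof -
  define f g where "f = (\<lambda>i x y. if alive c x y i then Im (h (walk x y i)) else 0)"
    and "g = (\<lambda>i x y. if alive c x y i then Re (h (walk x y i)) else 0)"
  have "stopped_sum c h x y n = (\<Sum>i<n. f i x y * x i + g i x y * y i)" for x y
    unfolding stopped_sum_def f_def g_def by (intro sum.cong) auto
  moreover have "(f i x y)\<^sup>2 + (g i x y)\<^sup>2 \<le> b\<^sup>2" for i x y
  proof (cases "alive c x y i")
    case True
    hence "norm (h (walk x y i)) \<le> b" by (intro h) (auto simp: alive_def)
    hence "(norm (h (walk x y i)))\<^sup>2 \<le> b\<^sup>2" by (intro power_mono) auto
    thus ?thesis using True by (simp add: f_def g_def cmod_power2 add.commute)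
  qed (simp add: f_def g_def)
  moreover have "predictable f" "predictable g"
    unfolding f_def g_def by (intro predictable_stopped[where f = "\<lambda>z. Im (h z)"] predictable_stopped[where f = "\<lambda>z. Re (h z)"]; measurable)+
  ultimately show ?thesis
    using nn_integral_exp_predictable_sum[OF s, of f g "b\<^sup>2" n] by simp
qed

text \<open>The witness is the first \<open>k\<close> at which the walk is no longer alive: all summands of a stopped sum
  before \<open>k\<close> are present, and all from \<open>k\<close> on vanish.\<close>

lemma exit_step:
  assumes dead: "\<not> alive c x y n"
  obtains k where "Re (walk x y k) \<le> 1 / 2 \<or> c \<le> \<bar>walk_winding x y k\<bar>"
    and "\<And>h. stopped_sum c h x y n = (\<Sum>i<k. Im (h (walk x y i) * Complex (x i) (y i)))"
proof -
  define k where "k = (LEAST k. \<not> alive c x y k)"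
  have dead_k: "\<not> alive c x y k" unfolding k_def using dead by (rule LeastI)
  have le: "k \<le> n" unfolding k_def using dead by (rule Least_le)
  have before: "alive c x y i" if "i < k" for i
    using not_less_Least[of i "\<lambda>k. \<not> alive c x y k"] that by (auto simp: k_def)
  have after: "\<not> alive c x y i" if "k \<le> i" for i
    using dead_k that by (auto simp: alive_def intro: order_trans)
  have "stopped_sum c h x y n = (\<Sum>i<k. Im (h (walk x y i) * Complex (x i) (y i)))" for h
    unfolding stopped_sum_def using le before after
    by (intro sum.mono_neutral_cong_right) (auto simp: not_less)
  moreover have "Re (walk x y k) \<le> 1 / 2 \<or> c \<le> \<bar>walk_winding x y k\<bar>"
  proof (rule ccontr)
    assume "\<not> ?thesis"
    hence "\<forall>j\<in>{..k}. 1 / 2 < Re (walk x y j) \<and> \<bar>walk_winding x y j\<bar> < c"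
      using before by (auto simp: alive_def le_less not_le)
    thus False using dead_k by (simp add: alive_def)
  qed
  ultimately show thesis using that by blast
qed

text \<open>A stopped walk has gone left by at least \<open>1 / 2\<close> or has winding at least \<open>c\<close> of either sign, so
  that one of the three exponents is at least \<open>l r\<close>. This is Markov's inequality in pointwise form.\<close>

lemma dead_le_exp_stopped_sums:
  assumes dead: "\<not> alive c x y n" and r: "r \<le> 1 / 2" "r \<le> c" and l: "0 \<le> l"
  shows "exp (l * r) \<le> exp (stopped_sum c (\<lambda>_. - \<i> * of_real l) x y n)
      + exp (stopped_sum c (\<lambda>z. of_real l / z) x y n)
      + exp (stopped_sum c (\<lambda>z. - of_real l / z) x y n)"
proof -
  obtain k where k: "Re (walk x y k) \<le> 1 / 2 \<or> c \<le> \<bar>walk_winding x y k\<bar>"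
    and sum: "\<And>h. stopped_sum c h x y n = (\<Sum>i<k. Im (h (walk x y i) * Complex (x i) (y i)))"
    using exit_step[OF dead] by blast
  have "stopped_sum c (\<lambda>_. - \<i> * l) x y n = l * (1 - Re (walk x y k))"
    by (simp add: sum walk_def sum_distrib_left sum_negf)
  moreover have "stopped_sum c (\<lambda>z. of_real l / z) x y n = l * walk_winding x y k"
  proof -
    have "Im (l / z * w) = l * Im (1 / z * w)" for z w :: complex
    proof -
      have "l / z * w = of_real l * (1 / z * w)" by simp
      also have "Im \<dots> = l * Im (1 / z * w)" by (simp only: times_complex.sel Re_complex_of_real Im_complex_of_real mult_zero_left add_0_right)
      finally show ?thesis .
    qed
    thus ?thesis by (simp only: sum walk_winding_def sum_distrib_left)
  qed
  moreover have "stopped_sum c (\<lambda>z. - of_real l / z) x y n = - stopped_sum c (\<lambda>z. of_real l / z) x y n"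
    by (simp add: sum sum_negf)
  moreover have "l * r \<le> l * (1 - Re (walk x y k)) \<or> l * r \<le> l * walk_winding x y k \<or>
     l * r \<le> l * - walk_winding x y k"
  proof -
    have "r \<le> 1 - Re (walk x y k) \<or> r \<le> walk_winding x y k \<or> r \<le> - walk_winding x y k"
      using k r by linarith
    thus ?thesis using mult_left_mono[OF _ l] by blast
  qed
  ultimately show ?thesis
    by (smt (verit) exp_gt_zero exp_le_cancel_iff mult_minus_right)
qed

text \<open>Each of the three exponentials has integral at most \<open>exp (2 l\<^sup>2 t)\<close>, where \<open>t = s\<^sup>2 n\<close> is the
  duration of the walk. The bound depends on the grid through \<open>t\<close> alone, which makes it survive the
  refinement of the grid.\<close>

lemma emeasure_dead_le:
  assumes s: "s > 0" and n: "n > 0" and r: "0 < r" "r \<le> 1 / 2" "r \<le> c"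
  shows "emeasure (gauss_seqs s n \<Otimes>\<^sub>M gauss_seqs s n)
           {p \<in> space (gauss_seqs s n \<Otimes>\<^sub>M gauss_seqs s n). \<not> alive c (fst p) (snd p) n}
         \<le> ennreal (3 * exp (- r\<^sup>2 / (8 * (s\<^sup>2 * n))))"
proof -
  define P where "P = gauss_seqs s n"
  have sets_P [measurable_cong]: "sets P = sets (real_seqs n)"
    unfolding P_def by (rule sets_PiM_cong) simp_all
  interpret P: prob_space P
    unfolding P_def by (rule prob_space_PiM) (rule prob_space_normal_density[OF s])
  note sets_PP [measurable_cong] = sets_pair_measure_cong[OF sets_P sets_P]
  \<comment> \<open>This value minimises the exponent \<open>- l r + 2 l\<^sup>2 (s\<^sup>2 n)\<close>.\<close>
  define l where "l = r / (4 * (s\<^sup>2 * n))"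
  have l: "0 \<le> l" using r by (simp add: l_def)
  define D where "D = (\<lambda>h p. ennreal (exp (stopped_sum c h (fst p) (snd p) n)))"
  have [measurable]: "D h \<in> borel_measurable (P \<Otimes>\<^sub>M P)"
    if [measurable]: "h \<in> borel_measurable borel" for h
  proof -
    have "(\<lambda>p. if alive c (fst p) (snd p) i
            then Im (h (walk (fst p) (snd p) i) * Complex (fst p i) (snd p i)) else 0)
          \<in> borel_measurable (real_seqs n \<Otimes>\<^sub>M real_seqs n)" if i: "i < n" for i
    proof -
      have [measurable]: "(\<lambda>x. x i) \<in> borel_measurable (real_seqs n)"
        using i by (intro measurable_component_singleton) auto
      note [measurable] = measurable_walk[OF less_imp_le[OF i]] measurable_alive[OF less_imp_le[OF i]]
      show ?thesis unfolding Complex_eq by measurable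
    qed
    thus ?thesis
      unfolding D_def stopped_sum_def
      by (intro measurable_compose[OF _ measurable_ennreal] measurable_compose[OF _ borel_measurable_exp]
            borel_measurable_sum)
         (auto cong: measurable_cong_sets simp: sets_PP)
  qed
  have D_le: "(\<integral>\<^sup>+p. D h p \<partial>(P \<Otimes>\<^sub>M P)) \<le> ennreal (exp (2 * l\<^sup>2 * (s\<^sup>2 * n)))"
    if [measurable]: "h \<in> borel_measurable borel" and "\<And>z. 1 / 2 < Re z \<Longrightarrow> norm (h z) \<le> 2 * l" for h
  proof -
    have "(\<integral>\<^sup>+p. D h p \<partial>(P \<Otimes>\<^sub>M P)) = (\<integral>\<^sup>+x. \<integral>\<^sup>+y. D h (x, y) \<partial>P \<partial>P)"
      by (rule P.nn_integral_fst[symmetric]) measurable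
    also have "\<dots> \<le> ennreal (exp ((2 * l)\<^sup>2 * s\<^sup>2 * n / 2))"
      using nn_integral_exp_stopped_sum[OF s that, of n c] l by (simp add: D_def P_def)
    finally show ?thesis by (simp add: power_mult_distrib mult_ac)
  qed
  note [measurable] = measurable_alive[OF order_refl[of n], of c]
  define h1 h2 h3 :: "complex \<Rightarrow> complex"
    where "h1 = (\<lambda>_. - \<i> * l)" and "h2 = (\<lambda>z::complex. of_real l / z)" and "h3 = (\<lambda>z::complex. - of_real l / z)"
  have [measurable]: "h1 \<in> borel_measurable borel" "h2 \<in> borel_measurable borel"
      "h3 \<in> borel_measurable borel"
    unfolding h1_def h2_def h3_def by measurable
  have div: "l / norm z \<le> 2 * l" if "1 / 2 < Re z" for z :: complex
  proof -
    have "1 / 2 < norm z" using that complex_Re_le_cmod[of z] by linarith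
    hence "l \<le> 2 * l * norm z"
      using l mult_left_mono[of 1 "2 * norm z" l] by simp
    moreover have "0 < norm z" using \<open>1 / 2 < norm z\<close> by linarith
    ultimately show ?thesis by (simp only: pos_divide_le_eq)
  qed
  have h: "norm (h1 z) \<le> 2 * l" "norm (h2 z) \<le> 2 * l" "norm (h3 z) \<le> 2 * l"
    if "1 / 2 < Re z" for z
    using l div[OF that] by (simp_all add: h1_def h2_def h3_def norm_mult norm_divide)
  have "emeasure (P \<Otimes>\<^sub>M P) {p \<in> space (P \<Otimes>\<^sub>M P). \<not> alive c (fst p) (snd p) n}
      = (\<integral>\<^sup>+p. indicator {p \<in> space (P \<Otimes>\<^sub>M P). \<not> alive c (fst p) (snd p) n} p \<partial>(P \<Otimes>\<^sub>M P))"
    by (rule nn_integral_indicator[symmetric]) measurable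
  also have "\<dots> \<le> (\<integral>\<^sup>+p. ennreal (exp (- (l * r))) * (D h1 p + D h2 p + D h3 p) \<partial>(P \<Otimes>\<^sub>M P))"
  proof (intro nn_integral_mono)
    fix p :: "(nat \<Rightarrow> real) \<times> (nat \<Rightarrow> real)"
    let ?S = "\<lambda>h. exp (stopped_sum c h (fst p) (snd p) n)"
    have "1 \<le> exp (- (l * r)) * (?S h1 + ?S h2 + ?S h3)" if "\<not> alive c (fst p) (snd p) n"
      using dead_le_exp_stopped_sums[OF that r(2,3) l]
      by (simp add: h1_def h2_def h3_def exp_minus field_simps)
    thus "indicator {p \<in> space (P \<Otimes>\<^sub>M P). \<not> alive c (fst p) (snd p) n} p
        \<le> ennreal (exp (- (l * r))) * (D h1 p + D h2 p + D h3 p)"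
      by (auto simp: D_def indicator_def ennreal_plus[symmetric] ennreal_mult'[symmetric]
          simp del: ennreal_plus)
  qed
  also have "\<dots> = ennreal (exp (- (l * r))) * ((\<integral>\<^sup>+p. D h1 p \<partial>(P \<Otimes>\<^sub>M P))
      + (\<integral>\<^sup>+p. D h2 p \<partial>(P \<Otimes>\<^sub>M P)) + (\<integral>\<^sup>+p. D h3 p \<partial>(P \<Otimes>\<^sub>M P)))"
    by (simp add: nn_integral_cmult nn_integral_add)
  also have "\<dots> \<le> ennreal (exp (- (l * r))) * (ennreal (exp (2 * l\<^sup>2 * (s\<^sup>2 * n)))
      + ennreal (exp (2 * l\<^sup>2 * (s\<^sup>2 * n))) + ennreal (exp (2 * l\<^sup>2 * (s\<^sup>2 * n))))"
    using h by (intro mult_left_mono add_mono D_le) auto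
  also have "\<dots> = ennreal (3 * exp (- (l * r) + 2 * l\<^sup>2 * (s\<^sup>2 * n)))"
    unfolding exp_add by (simp add: ennreal_plus[symmetric] ennreal_mult'[symmetric] del: ennreal_plus)
  also have "- (l * r) + 2 * l\<^sup>2 * (s\<^sup>2 * n) = - r\<^sup>2 / (8 * (s\<^sup>2 * n))"
    using s n by (simp add: l_def power2_eq_square field_simps)
  finally show ?thesis unfolding P_def .
qed

section \<open>Riemann sums of the winding on a uniform grid\<close>

lemma distr_brownian_grid_increments:
  assumes "prob_space M" and B: "brownian_motion M B x" and h: "h > 0" and n: "n > 0"
  shows "distr M (real_seqs n) (\<lambda>\<omega>. \<lambda>i\<in>{..<n}. B (real (Suc i) * h) \<omega> - B (real i * h) \<omega>)
       = gauss_seqs (sqrt h) n"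
proof -
  interpret prob_space M by fact
  have indep: "indep_vars (\<lambda>_. borel) (\<lambda>i \<omega>. B (real (Suc i) * h) \<omega> - B (real i * h) \<omega>) {..<n}"
  proof -
    have "0 \<le> real 0 * h \<and> (\<forall>i<n. real i * h \<le> real (Suc i) * h)"
      using h by auto
    moreover have "0 \<le> t 0 \<and> (\<forall>i<n. t i \<le> t (Suc i)) \<Longrightarrow>
        indep_vars (\<lambda>_. borel) (\<lambda>i \<omega>. B (t (Suc i)) \<omega> - B (t i) \<omega>) {..<n}" for t :: "nat \<Rightarrow> real"
      using B by (simp add: brownian_motion_def)
    from this[of "\<lambda>i. real i * h"] calculation show ?thesis by simp
  qed
  have law: "distr M borel (\<lambda>\<omega>. B (real (Suc i) * h) \<omega> - B (real i * h) \<omega>)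
      = density lborel (normal_density 0 (sqrt h))" for i
  proof -
    have "0 \<le> real i * h \<and> real i * h < real (Suc i) * h"
      using h by auto
    hence "distributed M lborel (\<lambda>\<omega>. B (real (Suc i) * h) \<omega> - B (real i * h) \<omega>)
        (normal_density 0 (sqrt (real (Suc i) * h - real i * h)))"
      using B by (simp add: brownian_motion_def)
    moreover have "real (Suc i) * h - real i * h = h" by (simp add: algebra_simps)
    moreover have "distr M borel f = distr M lborel f" for f :: "'a \<Rightarrow> real"
      by (rule distr_cong) simp_all
    ultimately show ?thesis by (simp add: distributed_def)
  qed
  have "distr M (real_seqs n) (\<lambda>\<omega>. \<lambda>i\<in>{..<n}. B (real (Suc i) * h) \<omega> - B (real i * h) \<omega>)
      = (\<Pi>\<^sub>M i\<in>{..<n}. distr M borel (\<lambda>\<omega>. B (real (Suc i) * h) \<omega> - B (real i * h) \<omega>))"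
    using indep n
    by (subst indep_vars_iff_distr_eq_PiM'[symmetric]) (auto simp: indep_vars_def)
  thus ?thesis by (simp only: law)
qed

text \<open>The increments on the grid are measurable functionals of the coordinate processes, and thus inherit
  their independence.\<close>

lemma distr_planar_grid_increments:
  assumes "prob_space M" and Z: "planar_brownian_motion M Z z" and h: "h > 0" and n: "n > 0"
  shows "distr M (real_seqs n \<Otimes>\<^sub>M real_seqs n)
       (\<lambda>\<omega>. (\<lambda>i\<in>{..<n}. Re (Z (real (Suc i) * h) \<omega>) - Re (Z (real i * h) \<omega>),
             \<lambda>i\<in>{..<n}. Im (Z (real (Suc i) * h) \<omega>) - Im (Z (real i * h) \<omega>)))
     = gauss_seqs (sqrt h) n \<Otimes>\<^sub>M gauss_seqs (sqrt h) n" (is "distr _ _ (\<lambda>\<omega>. (?X \<omega>, ?Y \<omega>)) = _")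
proof -
  interpret prob_space M by fact
  define \<Delta> where "\<Delta> = (\<lambda>f :: real \<Rightarrow> real. \<lambda>i\<in>{..<n}. f (real (Suc i) * h) - f (real i * h))"
  have [measurable]: "\<Delta> \<in> measurable (Pi\<^sub>M {0..} (\<lambda>_. borel)) (real_seqs n)"
    unfolding \<Delta>_def
  proof (rule measurable_restrict)
    fix i
    have eval: "(\<lambda>f :: real \<Rightarrow> real. f (real j * h)) \<in> borel_measurable (Pi\<^sub>M {0..} (\<lambda>_. borel))" for j
      using h by (intro measurable_component_singleton) auto
    show "(\<lambda>f :: real \<Rightarrow> real. f (real (Suc i) * h) - f (real i * h)) \<in> borel_measurable (Pi\<^sub>M {0..} (\<lambda>_. borel))"
      by (intro borel_measurable_diff eval)
  qed
  have "indep_var (real_seqs n) (\<Delta> \<circ> (\<lambda>\<omega>. \<lambda>t\<in>{0..}. Re (Z t \<omega>)))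
      (real_seqs n) (\<Delta> \<circ> (\<lambda>\<omega>. \<lambda>t\<in>{0..}. Im (Z t \<omega>)))"
    using Z unfolding planar_brownian_motion_def
    by (intro indep_var_compose[where ?M1.0 = "Pi\<^sub>M {0..} (\<lambda>_. borel)" and ?M2.0 = "Pi\<^sub>M {0..} (\<lambda>_. borel)"]) auto
  moreover have "\<Delta> \<circ> (\<lambda>\<omega>. \<lambda>t\<in>{0..}. Re (Z t \<omega>)) = ?X" "\<Delta> \<circ> (\<lambda>\<omega>. \<lambda>t\<in>{0..}. Im (Z t \<omega>)) = ?Y"
    using h by (auto simp: \<Delta>_def fun_eq_iff restrict_def)
  ultimately have "distr M (real_seqs n \<Otimes>\<^sub>M real_seqs n) (\<lambda>\<omega>. (?X \<omega>, ?Y \<omega>))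
      = distr M (real_seqs n) ?X \<Otimes>\<^sub>M distr M (real_seqs n) ?Y"
    by (simp add: indep_var_distribution_eq)
  also have "\<dots> = gauss_seqs (sqrt h) n \<Otimes>\<^sub>M gauss_seqs (sqrt h) n"
  proof -
    have X: "brownian_motion M (\<lambda>t \<omega>. Re (Z t \<omega>)) (Re z)"
      and Y: "brownian_motion M (\<lambda>t \<omega>. Im (Z t \<omega>)) (Im z)"
      using Z by (auto simp: planar_brownian_motion_def)
    show ?thesis
      by (simp only: distr_brownian_grid_increments[OF \<open>prob_space M\<close> X h n]
          distr_brownian_grid_increments[OF \<open>prob_space M\<close> Y h n])
  qed
  finally show ?thesis .
qed

lemma planar_brownian_measurable:
  assumes "planar_brownian_motion M Z z" "0 \<le> t"
  shows "Z t \<in> borel_measurable M"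
  using assms unfolding planar_brownian_motion_def brownian_motion_def
  by (auto simp: borel_measurable_complex_iff)

text \<open>Almost surely the planar Brownian motion starts at 1, and then its values at the grid points form
  the walk driven by its increments, with the imaginary parts of the Ito sums as winding.\<close>

lemma ito_sum_tail:
  assumes "prob_space M" and Z: "planar_brownian_motion M Z 1" and h: "h > 0" and n: "n > 0"
    and r: "0 < r" "r \<le> 1 / 2" "r \<le> c"
  shows "measure M {\<omega> \<in> space M.
           \<exists>k\<in>{..n}. c \<le> \<bar>Im (ito_sum (\<lambda>t \<omega>. 1 / Z t \<omega>) Z (\<lambda>i. real i * h) k \<omega>)\<bar>}
         \<le> 3 * exp (- r\<^sup>2 / (8 * (h * n)))"
proof -
  interpret prob_space M by fact
  define S where "S = (\<lambda>k \<omega>. Im (ito_sum (\<lambda>t \<omega>. 1 / Z t \<omega>) Z (\<lambda>i. real i * h) k \<omega>))"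
  define X where "X = (\<lambda>\<omega>. \<lambda>i\<in>{..<n}. Re (Z (real (Suc i) * h) \<omega>) - Re (Z (real i * h) \<omega>))"
  define Y where "Y = (\<lambda>\<omega>. \<lambda>i\<in>{..<n}. Im (Z (real (Suc i) * h) \<omega>) - Im (Z (real i * h) \<omega>))"
  let ?P = "gauss_seqs (sqrt h) n \<Otimes>\<^sub>M gauss_seqs (sqrt h) n"
  have [measurable]: "Z (real k * h) \<in> borel_measurable M" for k
    using h by (intro planar_brownian_measurable[OF Z]) auto
  have [measurable]: "X \<in> measurable M (real_seqs n)" "Y \<in> measurable M (real_seqs n)"
    unfolding X_def Y_def by (intro measurable_restrict; measurable)+
  have law: "distr M (real_seqs n \<Otimes>\<^sub>M real_seqs n) (\<lambda>\<omega>. (X \<omega>, Y \<omega>)) = ?P"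
    unfolding X_def Y_def by (rule distr_planar_grid_increments[OF \<open>prob_space M\<close> Z h n])
  have start: "AE \<omega> in M. Z 0 \<omega> = 1"
  proof -
    have "AE \<omega> in M. Re (Z 0 \<omega>) = 1" "AE \<omega> in M. Im (Z 0 \<omega>) = 0"
      using Z by (auto simp: planar_brownian_motion_def brownian_motion_def)
    thus ?thesis by eventually_elim (simp add: complex_eq_iff)
  qed
  have incr: "Complex (X \<omega> i) (Y \<omega> i) = Z (real (Suc i) * h) \<omega> - Z (real i * h) \<omega>" if "i < n" for i \<omega>
    using that by (simp add: X_def Y_def complex_eq_iff)
  have walk_eq: "walk (X \<omega>) (Y \<omega>) k = Z (real k * h) \<omega>" if "Z 0 \<omega> = 1" "k \<le> n" for k \<omega>
  proof -
    have "walk (X \<omega>) (Y \<omega>) k = 1 + (\<Sum>i<k. Z (real (Suc i) * h) \<omega> - Z (real i * h) \<omega>)"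
      unfolding walk_def using that incr by (intro arg_cong2[of _ _ _ _ "(+)"] sum.cong) auto
    also have "\<dots> = Z (real k * h) \<omega>"
      using that by (subst sum_lessThan_telescope) simp
    finally show ?thesis .
  qed
  have winding_eq: "walk_winding (X \<omega>) (Y \<omega>) k = S k \<omega>" if "Z 0 \<omega> = 1" "k \<le> n" for k \<omega>
    unfolding walk_winding_def S_def ito_sum_def Im_sum
    using that incr walk_eq by (intro sum.cong) auto
  define D where "D = {p \<in> space ?P. \<not> alive c (fst p) (snd p) n}"
  have sets_D: "D \<in> sets (real_seqs n \<Otimes>\<^sub>M real_seqs n)"
  proof -
    have "space ?P = space (real_seqs n \<Otimes>\<^sub>M real_seqs n)"
      by (simp add: space_pair_measure space_PiM)
    thus ?thesis using measurable_alive[OF order_refl[of n], of c] by (simp add: D_def)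
  qed
  have "emeasure M {\<omega> \<in> space M. \<exists>k\<in>{..n}. c \<le> \<bar>S k \<omega>\<bar>}
      \<le> emeasure M ((\<lambda>\<omega>. (X \<omega>, Y \<omega>)) -` D \<inter> space M)"
  proof (rule emeasure_mono_AE)
    show "AE \<omega> in M. \<omega> \<in> {\<omega> \<in> space M. \<exists>k\<in>{..n}. c \<le> \<bar>S k \<omega>\<bar>}
        \<longrightarrow> \<omega> \<in> (\<lambda>\<omega>. (X \<omega>, Y \<omega>)) -` D \<inter> space M"
      using start
    proof eventually_elim
      case (elim \<omega>)
      have "(X \<omega>, Y \<omega>) \<in> space ?P"
        by (auto simp: space_pair_measure space_PiM X_def Y_def)
      moreover have "\<not> alive c (X \<omega>) (Y \<omega>) n" if "k \<le> n" "c \<le> \<bar>S k \<omega>\<bar>" for k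
        using that winding_eq[OF elim, of k] by (force simp: alive_def)
      ultimately show ?case by (auto simp: D_def)
    qed
    show "(\<lambda>\<omega>. (X \<omega>, Y \<omega>)) -` D \<inter> space M \<in> sets M"
      using sets_D by (intro measurable_sets[of _ _ "real_seqs n \<Otimes>\<^sub>M real_seqs n"]) measurable
  qed
  also have "\<dots> = emeasure ?P D"
    unfolding law[symmetric] using sets_D by (intro emeasure_distr[symmetric]) measurable
  also have "\<dots> \<le> ennreal (3 * exp (- r\<^sup>2 / (8 * (h * n))))"
    using emeasure_dead_le[of "sqrt h" n r c] h n r by (simp add: D_def)
  finally show ?thesis by (simp add: emeasure_eq_measure S_def)
qed

section \<open>Small-time tail of the winding process\<close>

lemma partition_mesh_less_uniform:
  assumes "0 \<le> h" "h < \<delta>"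
  shows "partition_mesh_less (\<lambda>i. real i * h) N (real N * h) \<delta>"
  using assms by (auto simp: partition_mesh_less_def algebra_simps)

lemma ito_integral_convergence:
  assumes "ito_integral_process M H Z I" "0 \<le> t" "\<epsilon> > 0" "\<eta> > 0"
  obtains \<delta> where "\<delta> > 0" and "\<And>\<tau> N. partition_mesh_less \<tau> N t \<delta> \<Longrightarrow>
    measure M {\<omega> \<in> space M. \<epsilon> < norm (ito_sum H Z \<tau> N \<omega> - I t \<omega>)} < \<eta>"
proof -
  have "\<exists>\<delta>>0. \<forall>\<tau> N. partition_mesh_less \<tau> N t \<delta> \<longrightarrow>
      measure M {\<omega> \<in> space M. \<epsilon> < norm (ito_sum H Z \<tau> N \<omega> - I t \<omega>)} < \<eta>"
    using assms by (simp add: ito_integral_process_def)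
  thus thesis using that by blast
qed

text \<open>At time 0 the trivial partition has arbitrarily small mesh and its Ito sum is empty, so the
  limit in probability vanishes.\<close>

lemma ito_integral_at_0:
  assumes "prob_space M" and I: "ito_integral_process M H Z I"
  shows "AE \<omega> in M. I 0 \<omega> = 0"
proof -
  interpret prob_space M by fact
  have [measurable]: "I 0 \<in> borel_measurable M"
    using I by (simp add: ito_integral_process_def)
  have "AE \<omega> in M. norm (I 0 \<omega>) \<le> \<epsilon>" if e: "\<epsilon> > 0" for \<epsilon>
  proof -
    have small: "measure M {\<omega> \<in> space M. \<epsilon> < norm (I 0 \<omega>)} < \<eta>" if eta: "\<eta> > 0" for \<eta>
    proof -
      obtain \<delta> where "\<delta> > 0" and \<delta>: "\<And>\<tau> N. partition_mesh_less \<tau> N 0 \<delta> \<Longrightarrow>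
          measure M {\<omega> \<in> space M. \<epsilon> < norm (ito_sum H Z \<tau> N \<omega> - I 0 \<omega>)} < \<eta>"
        using ito_integral_convergence[OF I order_refl e eta] by blast
      \<comment> \<open>the partition without intervals\<close>
      have "partition_mesh_less (\<lambda>_. 0) 0 0 \<delta>" by (simp add: partition_mesh_less_def)
      from \<delta>[OF this] show ?thesis by (simp add: ito_sum_def)
    qed
    have "measure M {\<omega> \<in> space M. \<epsilon> < norm (I 0 \<omega>)} \<le> 0"
      by (rule field_le_epsilon) (simp add: small less_imp_le)
    hence "emeasure M {\<omega> \<in> space M. \<epsilon> < norm (I 0 \<omega>)} = 0"
      by (simp add: emeasure_eq_measure measure_le_0_iff)
    thus ?thesis by (subst AE_iff_measurable[OF _ refl]) (auto simp: not_le)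
  qed
  hence "AE \<omega> in M. \<forall>n. norm (I 0 \<omega>) \<le> 1 / real (Suc n)"
    by (subst AE_all_countable) simp
  thus ?thesis
  proof eventually_elim
    case (elim \<omega>)
    have "\<not> 0 < norm (I 0 \<omega>)"
    proof
      assume "0 < norm (I 0 \<omega>)"
      then obtain n where "inverse (real (Suc n)) < norm (I 0 \<omega>)"
        using reals_Archimedean by blast
      thus False using elim[rule_format, of n] by (simp add: inverse_eq_divide)
    qed
    thus ?case by simp
  qed
qed

text \<open>A point of the \<open>n\<close>-th dyadic grid of \<open>[0, t]\<close> belongs to every finer one, with index multiplied
  by \<open>2 ^ (m - n)\<close>. Hence a single sequence of uniform partitions of \<open>[0, t]\<close> approximates the
  integral at all points of the coarse grid.\<close>

lemma ito_sum_uniform_convergence: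
  assumes I: "ito_integral_process M H Z I" and t: "t > 0" and "\<epsilon> > 0" "\<eta> > 0"
  shows "\<forall>\<^sub>F m in sequentially. n \<le> m \<and>
    measure M {\<omega> \<in> space M. \<epsilon> < norm (ito_sum H Z (\<lambda>i. real i * (t / 2 ^ m)) (k * 2 ^ (m - n)) \<omega>
       - I (real k * (t / 2 ^ n)) \<omega>)} < \<eta>"
proof -
  have "0 \<le> real k * (t / 2 ^ n)" using t by simp
  then obtain \<delta> where "\<delta> > 0" and \<delta>: "\<And>\<tau> N. partition_mesh_less \<tau> N (real k * (t / 2 ^ n)) \<delta> \<Longrightarrow>
      measure M {\<omega> \<in> space M. \<epsilon> < norm (ito_sum H Z \<tau> N \<omega> - I (real k * (t / 2 ^ n)) \<omega>)} < \<eta>"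
    using ito_integral_convergence[OF I _ assms(3,4)] by blast
  have "(\<lambda>m. t / 2 ^ m) \<longlonglongrightarrow> 0" by real_asymp
  hence "\<forall>\<^sub>F m in sequentially. t / 2 ^ m < \<delta>"
    using \<open>\<delta> > 0\<close> by (simp add: order_tendstoD)
  thus ?thesis using eventually_ge_at_top[of n]
  proof eventually_elim
    case (elim m)
    have "real (k * 2 ^ (m - n)) * (t / 2 ^ m) = real k * (t / 2 ^ n)"
      using elim by (simp add: field_simps power_add[symmetric])
    with partition_mesh_less_uniform[of "t / 2 ^ m" \<delta> "k * 2 ^ (m - n)"] elim t
    show ?case by (intro conjI \<delta>) auto
  qed
qed

text \<open>Up to an arbitrarily small probability, the integral is within \<open>c\<close> of the Ito sums over a fine
  grid at all points of the coarse grid; so if it exceeds \<open>2 c\<close> at one of them, some Ito sum is at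
  least \<open>c\<close>. The bound for the Ito sums does not depend on the fine grid.\<close>

lemma winding_tail_grid:
  assumes "prob_space M" and Z: "planar_brownian_motion M Z 1"
    and I: "ito_integral_process M (\<lambda>t \<omega>. 1 / Z t \<omega>) Z I"
    and t: "t > 0" and r: "0 < r" "r \<le> 1 / 2" "r \<le> c"
  shows "measure M {\<omega> \<in> space M. \<exists>k\<in>{..2 ^ n}. 2 * c < \<bar>Im (I (real k * (t / 2 ^ n)) \<omega>)\<bar>}
         \<le> 3 * exp (- r\<^sup>2 / (8 * t))"
proof (rule field_le_epsilon)
  fix e :: real assume e: "e > 0"
  interpret prob_space M by fact
  have [measurable]: "I (real k * (t / 2 ^ n)) \<in> borel_measurable M" for k
    using I t by (simp add: ito_integral_process_def)
  have [measurable]: "Z (real k * (t / 2 ^ m)) \<in> borel_measurable M" for k m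
    using t by (intro planar_brownian_measurable[OF Z]) auto
  define S where "S = (\<lambda>m. ito_sum (\<lambda>t \<omega>. 1 / Z t \<omega>) Z (\<lambda>i. real i * (t / 2 ^ m)))"
  have [measurable]: "S m k \<in> borel_measurable M" for m k
    unfolding S_def ito_sum_def by measurable
  \<comment> \<open>The error \<open>e\<close> is shared equally by the \<open>2 ^ n + 1\<close> points of the coarse grid.\<close>
  define \<eta> where "\<eta> = e / real (card {..(2::nat) ^ n})"
  have \<eta>: "\<eta> > 0" using e by (simp add: \<eta>_def del: of_nat_Suc)
  define B where "B = (\<lambda>m k. {\<omega> \<in> space M.
     c < norm (S m (k * 2 ^ (m - n)) \<omega> - I (real k * (t / 2 ^ n)) \<omega>)})"
  have "\<forall>\<^sub>F m in sequentially. \<forall>k\<in>{..2 ^ n}. n \<le> m \<and> measure M (B m k) < \<eta>"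
    unfolding B_def S_def using r
    by (intro eventually_ball_finite ballI ito_sum_uniform_convergence[OF I t _ \<eta>]) auto
  then obtain m where m: "n \<le> m" "\<And>k. k \<in> {..2 ^ n} \<Longrightarrow> measure M (B m k) < \<eta>"
    by (auto simp: eventually_at_top_linorder)
  define A where "A = {\<omega> \<in> space M. \<exists>k\<in>{..2 ^ m}. c \<le> \<bar>Im (S m k \<omega>)\<bar>}"
  have [measurable]: "A \<in> sets M" "B m k \<in> sets M" for k
    unfolding A_def B_def by measurable
  have "{\<omega> \<in> space M. \<exists>k\<in>{..2 ^ n}. 2 * c < \<bar>Im (I (real k * (t / 2 ^ n)) \<omega>)\<bar>}
      \<subseteq> A \<union> (\<Union>k\<in>{..2 ^ n}. B m k)"
  proof
    fix \<omega> assume "\<omega> \<in> {\<omega> \<in> space M. \<exists>k\<in>{..2 ^ n}. 2 * c < \<bar>Im (I (real k * (t / 2 ^ n)) \<omega>)\<bar>}"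
    then obtain k where \<omega>: "\<omega> \<in> space M" and k: "k \<le> 2 ^ n"
      and large: "2 * c < \<bar>Im (I (real k * (t / 2 ^ n)) \<omega>)\<bar>" by blast
    show "\<omega> \<in> A \<union> (\<Union>k\<in>{..2 ^ n}. B m k)"
    proof (cases "\<omega> \<in> B m k")
      case False
      hence "norm (S m (k * 2 ^ (m - n)) \<omega> - I (real k * (t / 2 ^ n)) \<omega>) \<le> c"
        using \<omega> by (simp add: B_def)
      hence "c \<le> \<bar>Im (S m (k * 2 ^ (m - n)) \<omega>)\<bar>"
        using large abs_Im_le_cmod[of "S m (k * 2 ^ (m - n)) \<omega> - I (real k * (t / 2 ^ n)) \<omega>"] by simp
      moreover have "k * 2 ^ (m - n) \<le> 2 ^ m"
        using mult_right_mono[OF k, of "2 ^ (m - n)"] m(1) by (simp add: power_add[symmetric])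
      ultimately show ?thesis using \<omega> by (auto simp: A_def)
    qed (use k in auto)
  qed
  hence "measure M {\<omega> \<in> space M. \<exists>k\<in>{..2 ^ n}. 2 * c < \<bar>Im (I (real k * (t / 2 ^ n)) \<omega>)\<bar>}
      \<le> measure M (A \<union> (\<Union>k\<in>{..2 ^ n}. B m k))"
    by (intro finite_measure_mono) auto
  also have "\<dots> \<le> measure M A + measure M (\<Union>k\<in>{..2 ^ n}. B m k)"
    by (intro measure_Un_le) auto
  also have "measure M A \<le> 3 * exp (- r\<^sup>2 / (8 * t))"
    using ito_sum_tail[OF \<open>prob_space M\<close> Z, of "t / 2 ^ m" "2 ^ m" r c] t r by (simp add: A_def S_def)
  also have "measure M (\<Union>k\<in>{..2 ^ n}. B m k) \<le> (\<Sum>k\<in>{..2 ^ n}. measure M (B m k))"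
    by (intro finite_measure_subadditive_finite) auto
  also have "\<dots> \<le> (\<Sum>k\<in>{..(2::nat) ^ n}. \<eta>)"
    using m(2) by (intro sum_mono) (auto intro: less_imp_le)
  also have "\<dots> = e"
    by (simp add: \<eta>_def del: of_nat_Suc)
  finally show "measure M {\<omega> \<in> space M. \<exists>k\<in>{..2 ^ n}. 2 * c < \<bar>Im (I (real k * (t / 2 ^ n)) \<omega>)\<bar>}
      \<le> 3 * exp (- r\<^sup>2 / (8 * t)) + e" by simp
qed

lemma dyadic_witness:
  fixes f :: "real \<Rightarrow> real"
  assumes f: "continuous_on {0..} f" and s: "0 \<le> s" "s < t" and gt: "b < f s"
  obtains n k where "k \<in> {..2 ^ n}" "b < f (real k * (t / 2 ^ n))"
proof -
  obtain \<delta> where "\<delta> > 0" and \<delta>: "\<And>u. 0 \<le> u \<Longrightarrow> dist u s < \<delta> \<Longrightarrow> dist (f u) (f s) < f s - b"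
  proof -
    have "\<exists>\<delta>>0. \<forall>u\<in>{0..}. dist u s < \<delta> \<longrightarrow> dist (f u) (f s) < f s - b"
      using f s gt by (simp add: continuous_on_iff)
    thus thesis using that by auto
  qed
  have t: "t > 0" using s by simp
  have "(\<lambda>n. t / 2 ^ n) \<longlonglongrightarrow> 0" by real_asymp
  hence "\<forall>\<^sub>F n in sequentially. t / 2 ^ n < \<delta>"
    using \<open>\<delta> > 0\<close> by (rule order_tendstoD)
  then obtain n where n: "t / 2 ^ n < \<delta>"
    by (auto simp: eventually_at_top_linorder)
  define h where "h = t / 2 ^ n"
  have h: "h > 0" using t by (simp add: h_def)
  \<comment> \<open>Rounding \<open>s\<close> down to the grid of mesh \<open>h < \<delta>\<close> keeps it below \<open>t\<close>.\<close>
  define k where "k = nat \<lfloor>s / h\<rfloor>"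
  have "0 \<le> s / h" using s h by simp
  hence k_real: "real k = of_int \<lfloor>s / h\<rfloor>" by (simp add: k_def)
  have k: "real k \<le> s / h" "s / h < real k + 1"
    unfolding k_real by (rule of_int_floor_le) (rule real_of_int_floor_add_one_gt)
  have "s / h \<le> 2 ^ n" using s t by (simp add: h_def field_simps)
  with k(1) have "real k \<le> 2 ^ n" by (rule order_trans)
  hence "k \<in> {..2 ^ n}" by simp
  moreover have "real k * h \<le> s" "s < real k * h + h"
    using k h by (simp_all add: field_simps)
  hence "dist (real k * h) s < \<delta>" using n by (simp add: dist_real_def h_def)
  hence "dist (f (real k * h)) (f s) < f s - b" using h by (intro \<delta>) auto
  hence "b < f (real k * h)" by (auto simp: dist_real_def abs_if split: if_splits)
  ultimately show thesis using that unfolding h_def by blast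
qed

text \<open>If the continuous process \<open>\<bar>\<theta>\<bar>\<close> takes the value \<open>c\<close> before time \<open>t\<close>, it exceeds \<open>2 r < c\<close> at some
  dyadic point, and then at points of all finer dyadic grids. So the event is covered by an
  increasing union of events with a common bound. The covering set \<open>G\<close> makes the statement
  independent of the measurability of the hitting time.\<close>

lemma winding_tail:
  assumes "prob_space M" and Z: "planar_brownian_motion M Z 1" and \<theta>: "winding_process M Z \<theta>"
    and t: "t > 0" and r: "0 < r" "r \<le> 1 / 2" "2 * r < c"
  obtains G where "G \<in> sets M" "emeasure M G \<le> ennreal (3 * exp (- r\<^sup>2 / (8 * t)))"
    "AE \<omega> in M. \<forall>s. 0 \<le> s \<and> s < t \<and> \<bar>\<theta> s \<omega>\<bar> = c \<longrightarrow> \<omega> \<in> G"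
proof -
  interpret prob_space M by fact
  obtain I where I: "ito_integral_process M (\<lambda>t \<omega>. 1 / Z t \<omega>) Z I"
    and \<theta>_eq: "\<theta> = (\<lambda>t \<omega>. Im (I t \<omega>))"
    using \<theta> unfolding winding_process_def by blast
  have I_meas: "I (real k * (t / 2 ^ n)) \<in> borel_measurable M" for k n
    using I t by (simp add: ito_integral_process_def)
  define E where "E = (\<lambda>n. {\<omega> \<in> space M.
    \<exists>k\<in>{..2 ^ n}. 2 * r < \<bar>Im (I (real k * (t / 2 ^ n)) \<omega>)\<bar>})"
  have sets_E: "E n \<in> sets M" for n
    using I_meas unfolding E_def by measurable
  have "incseq E"
  proof (rule incseq_SucI, rule subsetI)
    fix n \<omega> assume "\<omega> \<in> E n"
    then obtain k where "\<omega> \<in> space M" "k \<le> 2 ^ n" "2 * r < \<bar>Im (I (real k * (t / 2 ^ n)) \<omega>)\<bar>"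
      by (auto simp: E_def)
    moreover have "real k * (t / 2 ^ n) = real (2 * k) * (t / 2 ^ Suc n)" by simp
    ultimately show "\<omega> \<in> E (Suc n)"
      unfolding E_def by (intro CollectI conjI bexI[of _ "2 * k"]) auto
  qed
  hence "emeasure M (\<Union>n. E n) = (SUP n. emeasure M (E n))"
    using sets_E by (intro SUP_emeasure_incseq[symmetric]) auto
  also have "\<dots> \<le> ennreal (3 * exp (- r\<^sup>2 / (8 * t)))"
    using winding_tail_grid[OF \<open>prob_space M\<close> Z I t r(1,2) order_refl]
    by (intro SUP_least) (simp add: E_def emeasure_eq_measure ennreal_leI)
  finally have le: "emeasure M (\<Union>n. E n) \<le> ennreal (3 * exp (- r\<^sup>2 / (8 * t)))" .
  have "AE \<omega> in M. continuous_on {0..} (\<lambda>t. I t \<omega>)"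
    using I by (simp add: ito_integral_process_def)
  with AE_space have "AE \<omega> in M. \<forall>s. 0 \<le> s \<and> s < t \<and> \<bar>\<theta> s \<omega>\<bar> = c \<longrightarrow> \<omega> \<in> (\<Union>n. E n)"
  proof eventually_elim
    case (elim \<omega>)
    show ?case
    proof (intro allI impI)
      fix s assume s: "0 \<le> s \<and> s < t \<and> \<bar>\<theta> s \<omega>\<bar> = c"
      have "continuous_on {0..} (\<lambda>t. \<bar>Im (I t \<omega>)\<bar>)"
        using elim(2) by (intro continuous_intros)
      then obtain n k where "k \<in> {..2 ^ n}" "2 * r < \<bar>Im (I (real k * (t / 2 ^ n)) \<omega>)\<bar>"
        using s r(3) by (elim dyadic_witness[of _ s t "2 * r"]) (auto simp: \<theta>_eq)
      thus "\<omega> \<in> (\<Union>n. E n)" using elim(1) by (auto simp: E_def)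
    qed
  qed
  thus thesis using that[of "\<Union>n. E n"] le sets_E by blast
qed

section \<open>Negative moments from the tail\<close>

lemma inverse_powr_antimono:
  assumes "T \<le> T'" "p > 0"
  shows "inverse_powr T' p \<le> inverse_powr T p"
proof (cases "T = 0 \<or> T' = \<infinity>")
  case True
  thus ?thesis by (auto simp: inverse_powr_def)
next
  case False
  hence fin: "T \<noteq> 0" "T < top" "T' < top"
    using assms(1) by (auto simp: less_top[symmetric] top_unique)
  hence "0 < enn2real T" "enn2real T \<le> enn2real T'"
    using assms(1) by (auto simp: enn2real_positive_iff zero_less_iff_neq_zero intro: enn2real_mono)
  hence "1 / enn2real T' powr p \<le> 1 / enn2real T powr p"
    using assms(2) by (intro divide_left_mono powr_mono2 mult_pos_pos) auto
  thus ?thesis using fin assms(1) by (auto simp: inverse_powr_def intro: ennreal_leI)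
qed

text \<open>If \<open>1 / (n + 2) \<le> T < 1 / (n + 1)\<close>, then the \<open>n\<close>-th summand alone dominates the left-hand side;
  if \<open>T \<ge> 1\<close>, the summand 1 does.\<close>

lemma inverse_powr_le_suminf:
  assumes T: "T \<noteq> 0" and p: "p > 0"
  shows "inverse_powr T p \<le> 1 + (\<Sum>n. ennreal (real (n + 2) powr p) *
            indicator {T. T < ennreal (1 / real (Suc n))} T)"
proof (cases "1 \<le> T")
  case True
  have "inverse_powr T p \<le> inverse_powr 1 p"
    by (rule inverse_powr_antimono[OF True p])
  also have "\<dots> = 1" by (simp add: inverse_powr_def)
  finally show ?thesis by (rule order_trans) simp
next
  case False
  then obtain t where t: "T = ennreal t" "0 < t" "t < 1"
    using T by (cases T) (auto simp: not_le)
  define n where "n = nat (\<lceil>1 / t\<rceil> - 2)"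
  have "1 < 1 / t" using t by simp
  hence "2 \<le> \<lceil>1 / t\<rceil>" by linarith
  hence n: "real n = of_int \<lceil>1 / t\<rceil> - 2" by (simp add: n_def)
  hence "real (Suc n) < 1 / t" "1 / t \<le> real (n + 2)"
    using ceiling_correct[of "1 / t"] by auto
  hence lt: "t < 1 / real (Suc n)" and le: "1 / t \<le> real (n + 2)"
    using t by (simp_all add: field_simps)
  have "inverse_powr T p = ennreal ((1 / t) powr p)"
    using t by (simp add: inverse_powr_def powr_divide)
  also have "\<dots> \<le> ennreal (real (n + 2) powr p)"
    using le t p by (intro ennreal_leI powr_mono2) auto
  also have "\<dots> = (\<Sum>k\<in>{n}. ennreal (real (k + 2) powr p) *
      indicator {T. T < ennreal (1 / real (Suc k))} T)"
    using lt t by (simp add: ennreal_less_iff)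
  also have "\<dots> \<le> (\<Sum>k. ennreal (real (k + 2) powr p) *
      indicator {T. T < ennreal (1 / real (Suc k))} T)"
    by (rule sum_le_suminf) auto
  finally show ?thesis by (rule order_trans) simp
qed

text \<open>Integrating the preceding bound termwise gives the series with terms
  \<open>(n + 2) powr p * exp (- \<kappa> (n + 1))\<close>. The sets \<open>G n\<close> stand for the events \<open>T < 1 / (n + 1)\<close>, which
  need not be measurable.\<close>

lemma nn_integral_inverse_powr_finite:
  assumes p: "p > 0" and \<kappa>: "\<kappa> > 0" and pos: "AE \<omega> in M. T \<omega> \<noteq> 0" and fin: "emeasure M (space M) < \<infinity>"
    and G: "\<And>n. G n \<in> sets M" "\<And>n. emeasure M (G n) \<le> ennreal (C * exp (- \<kappa> * real (Suc n)))"
    and TG: "\<And>n. AE \<omega> in M. T \<omega> < ennreal (1 / real (Suc n)) \<longrightarrow> \<omega> \<in> G n"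
    and C: "0 \<le> C"
  shows "(\<integral>\<^sup>+\<omega>. inverse_powr (T \<omega>) p \<partial>M) < \<infinity>"
proof -
  note [measurable] = G(1)
  define w where "w = (\<lambda>n. real (n + 2) powr p)"
  have "AE \<omega> in M. \<forall>n. T \<omega> < ennreal (1 / real (Suc n)) \<longrightarrow> \<omega> \<in> G n"
    using TG by (subst AE_all_countable) blast
  with pos have "AE \<omega> in M. inverse_powr (T \<omega>) p \<le> 1 + (\<Sum>n. ennreal (w n) * indicator (G n) \<omega>)"
  proof eventually_elim
    case (elim \<omega>)
    have "(\<Sum>n. ennreal (w n) * indicator {T. T < ennreal (1 / real (Suc n))} (T \<omega>))
        \<le> (\<Sum>n. ennreal (w n) * indicator (G n) \<omega>)"
      using elim(2) by (intro suminf_le mult_left_mono) (auto simp: indicator_def)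
    hence "1 + (\<Sum>n. ennreal (w n) * indicator {T. T < ennreal (1 / real (Suc n))} (T \<omega>))
        \<le> 1 + (\<Sum>n. ennreal (w n) * indicator (G n) \<omega>)"
      by (rule add_left_mono)
    with inverse_powr_le_suminf[OF elim(1) p] show ?case
      unfolding w_def by (rule order_trans)
  qed
  hence "(\<integral>\<^sup>+\<omega>. inverse_powr (T \<omega>) p \<partial>M) \<le> (\<integral>\<^sup>+\<omega>. 1 + (\<Sum>n. ennreal (w n) * indicator (G n) \<omega>) \<partial>M)"
    by (rule nn_integral_mono_AE)
  also have "\<dots> = emeasure M (space M) + (\<Sum>n. ennreal (w n) * emeasure M (G n))"
    by (simp add: nn_integral_add nn_integral_suminf nn_integral_cmult_indicator)
  also have "\<dots> \<le> emeasure M (space M) + (\<Sum>n. ennreal (w n * (C * exp (- \<kappa> * real (Suc n)))))"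
  proof (intro add_left_mono suminf_le)
    fix n
    have "ennreal (w n) * emeasure M (G n) \<le> ennreal (w n) * ennreal (C * exp (- \<kappa> * real (Suc n)))"
      by (intro mult_left_mono G(2)) simp
    also have "\<dots> = ennreal (w n * (C * exp (- \<kappa> * real (Suc n))))"
      by (rule ennreal_mult'[symmetric]) (simp add: w_def)
    finally show "ennreal (w n) * emeasure M (G n) \<le> ennreal (w n * (C * exp (- \<kappa> * real (Suc n))))" .
  qed simp_all
  also have "\<dots> < \<infinity>"
  proof -
    have "summable (\<lambda>n. w n * exp (- \<kappa> * real (Suc n)))"
    proof (rule summable_comparison_test_bigo)
      show "summable (\<lambda>n. norm (1 / real n ^ 2))"
        using inverse_power_summable[of 2] by (simp add: inverse_eq_divide)
      show "(\<lambda>n. w n * exp (- \<kappa> * real (Suc n))) \<in> O(\<lambda>n. 1 / real n ^ 2)"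
        unfolding w_def using p \<kappa> by real_asymp
    qed
    hence "summable (\<lambda>n. w n * (C * exp (- \<kappa> * real (Suc n))))"
      by (subst mult.left_commute) (rule summable_mult)
    hence "(\<Sum>n. ennreal (w n * (C * exp (- \<kappa> * real (Suc n))))) \<noteq> top"
      using C by (subst suminf_ennreal2) (auto simp: w_def)
    thus ?thesis using fin by (simp add: less_top)
  qed
  finally show ?thesis .
qed

section \<open>The hitting times of the winding process\<close>

lemma T_exit_le_T_one: "T_exit \<theta> d c \<omega> \<le> T_one \<theta> c \<omega>"
  unfolding T_exit_def T_one_def hitting_time_def by (rule INF_superset_mono) auto

text \<open>A path that starts at 0 and has left \<open>(- d, c)\<close> has \<open>\<bar>\<theta>\<bar> \<ge> c\<close> at that time, because \<open>c \<le> d\<close>; by the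
  intermediate value theorem \<open>\<bar>\<theta>\<bar>\<close> has taken the value \<open>c\<close> before.\<close>

lemma T_abs_le_T_exit:
  assumes cont: "continuous_on {0..} (\<lambda>t. \<theta> t \<omega>)" and start: "\<theta> 0 \<omega> = 0" and cd: "0 < c" "c \<le> d"
  shows "T_abs \<theta> c \<omega> \<le> T_exit \<theta> d c \<omega>"
  unfolding T_exit_def hitting_time_def
proof (rule INF_greatest)
  fix t assume "t \<in> {t. 0 \<le> t \<and> \<theta> t \<omega> \<in> - {- d<..<c}}"
  hence t: "0 \<le> t" "c \<le> \<bar>\<theta> t \<omega>\<bar>" using cd by auto
  have "continuous_on {0..t} (\<lambda>t. \<bar>\<theta> t \<omega>\<bar>)"
    using continuous_on_subset[OF cont] by (intro continuous_intros) auto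
  then obtain s where "0 \<le> s" "s \<le> t" "\<bar>\<theta> s \<omega>\<bar> = c"
    using IVT'[of "\<lambda>t. \<bar>\<theta> t \<omega>\<bar>" 0 c t] t start cd by auto
  thus "T_abs \<theta> c \<omega> \<le> ennreal t"
    unfolding T_abs_def hitting_time_def by (intro INF_lower2[of s]) (auto intro: ennreal_leI)
qed

lemma T_abs_nonzero:
  assumes cont: "continuous_on {0..} (\<lambda>t. \<theta> t \<omega>)" and start: "\<theta> 0 \<omega> = 0" and c: "0 < c"
  shows "T_abs \<theta> c \<omega> \<noteq> 0"
proof -
  have "\<exists>\<delta>>0. \<forall>t\<in>{0..}. dist t 0 < \<delta> \<longrightarrow> dist (\<theta> t \<omega>) (\<theta> 0 \<omega>) < c"
    using cont[unfolded continuous_on_iff, THEN bspec, of 0, THEN spec, of c, THEN mp, OF _ c] by simp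
  then obtain \<delta> where "\<delta> > 0" and \<delta>: "\<And>t. 0 \<le> t \<Longrightarrow> t < \<delta> \<Longrightarrow> \<bar>\<theta> t \<omega>\<bar> < c"
    using start by auto
  have "ennreal \<delta> \<le> T_abs \<theta> c \<omega>"
    unfolding T_abs_def hitting_time_def
  proof (rule INF_greatest)
    fix t assume "t \<in> {t. 0 \<le> t \<and> \<bar>\<theta> t \<omega>\<bar> \<in> {c}}"
    thus "ennreal \<delta> \<le> ennreal t" using \<delta>[of t] by (intro ennreal_leI) force
  qed
  thus ?thesis using \<open>\<delta> > 0\<close> by auto
qed

text \<open>The Gaussian tail of the winding before time \<open>t = 1 / (n + 1)\<close> is exponentially small in \<open>n\<close>.\<close>

lemma nn_integral_inverse_powr_T_abs_finite:
  assumes "prob_space M" and Z: "planar_brownian_motion M Z 1" and \<theta>: "winding_process M Z \<theta>"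
    and c: "0 < c" and p: "0 < p" and pos: "AE \<omega> in M. T_abs \<theta> c \<omega> \<noteq> 0"
  shows "(\<integral>\<^sup>+\<omega>. inverse_powr (T_abs \<theta> c \<omega>) p \<partial>M) < \<infinity>"
proof -
  interpret prob_space M by fact
  \<comment> \<open>Any positive \<open>r \<le> 1 / 2\<close> with \<open>2 r < c\<close> would do.\<close>
  define r where "r = min (1 / 2) (c / 3)"
  have r: "0 < r" "r \<le> 1 / 2" "2 * r < c" using c by (auto simp: r_def)
  define good where "good = (\<lambda>n G. G \<in> sets M \<and>
      emeasure M G \<le> ennreal (3 * exp (- (r\<^sup>2 / 8) * real (Suc n))) \<and>
      (AE \<omega> in M. T_abs \<theta> c \<omega> < ennreal (1 / real (Suc n)) \<longrightarrow> \<omega> \<in> G))"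
  have "\<exists>G. good n G" for n
  proof -
    obtain G where G: "G \<in> sets M" "emeasure M G \<le> ennreal (3 * exp (- r\<^sup>2 / (8 * (1 / real (Suc n)))))"
      "AE \<omega> in M. \<forall>s. 0 \<le> s \<and> s < 1 / real (Suc n) \<and> \<bar>\<theta> s \<omega>\<bar> = c \<longrightarrow> \<omega> \<in> G"
      using winding_tail[OF \<open>prob_space M\<close> Z \<theta> _ r, of "1 / real (Suc n)"] by auto
    have early: "T_abs \<theta> c \<omega> < ennreal u \<Longrightarrow> \<exists>s. 0 \<le> s \<and> s < u \<and> \<bar>\<theta> s \<omega>\<bar> = c" for \<omega> u
      by (auto simp: T_abs_def hitting_time_def INF_less_iff ennreal_less_iff)
    from G(3) have "AE \<omega> in M. T_abs \<theta> c \<omega> < ennreal (1 / real (Suc n)) \<longrightarrow> \<omega> \<in> G"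
    proof eventually_elim
      case (elim \<omega>)
      thus ?case using early[of \<omega> "1 / real (Suc n)"] by blast
    qed
    moreover have "- r\<^sup>2 / (8 * (1 / real (Suc n))) = - (r\<^sup>2 / 8) * real (Suc n)" by simp
    ultimately show ?thesis using G(1,2) by (intro exI[of _ G]) (simp only: good_def simp_thms)
  qed
  then obtain G where G: "\<And>n. good n (G n)" by metis
  show ?thesis
  proof (rule nn_integral_inverse_powr_finite[OF p _ pos])
    show "0 < r\<^sup>2 / 8" using r(1) by simp
    show "emeasure M (space M) < \<infinity>" by (simp add: emeasure_space_1)
    show "G n \<in> sets M" "emeasure M (G n) \<le> ennreal (3 * exp (- (r\<^sup>2 / 8) * real (Suc n)))"
      "AE \<omega> in M. T_abs \<theta> c \<omega> < ennreal (1 / real (Suc n)) \<longrightarrow> \<omega> \<in> G n" for n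
      using G[of n] by (simp_all only: good_def)
  qed simp
qed

theorem corollary2p2:
  fixes M :: "'a measure"
    and Z :: "real \<Rightarrow> 'a \<Rightarrow> complex"
    and \<theta> :: "real \<Rightarrow> 'a \<Rightarrow> real"
    and c d :: real
  assumes "prob_space M"
    and "planar_brownian_motion M Z 1"
    and "winding_process M Z \<theta>"
    and "0 < c" and "c < d"
  shows "(AE \<omega> in M. T_one \<theta> c \<omega> \<ge> T_exit \<theta> d c \<omega> \<and> T_exit \<theta> d c \<omega> \<ge> T_abs \<theta> c \<omega>) \<and>
    (\<forall>p>0.
      (\<integral>\<^sup>+\<omega>. inverse_powr (T_one \<theta> c \<omega>) p \<partial>M) \<le> (\<integral>\<^sup>+\<omega>. inverse_powr (T_exit \<theta> d c \<omega>) p \<partial>M) \<and>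
      (\<integral>\<^sup>+\<omega>. inverse_powr (T_exit \<theta> d c \<omega>) p \<partial>M) \<le> (\<integral>\<^sup>+\<omega>. inverse_powr (T_abs \<theta> c \<omega>) p \<partial>M) \<and>
      (\<integral>\<^sup>+\<omega>. inverse_powr (T_abs \<theta> c \<omega>) p \<partial>M) < \<infinity>)"
proof -
  obtain I where I: "ito_integral_process M (\<lambda>t \<omega>. 1 / Z t \<omega>) Z I"
    and \<theta>_eq: "\<theta> = (\<lambda>t \<omega>. Im (I t \<omega>))"
    using assms(3) unfolding winding_process_def by blast
  have "AE \<omega> in M. continuous_on {0..} (\<lambda>t. I t \<omega>)"
    using I by (simp add: ito_integral_process_def)
  hence paths: "AE \<omega> in M. continuous_on {0..} (\<lambda>t. \<theta> t \<omega>) \<and> \<theta> 0 \<omega> = 0"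
    using ito_integral_at_0[OF assms(1) I]
    by eventually_elim (auto simp: \<theta>_eq intro!: continuous_intros)
  hence abs_exit: "AE \<omega> in M. T_abs \<theta> c \<omega> \<le> T_exit \<theta> d c \<omega>"
    by eventually_elim (use assms(4,5) in \<open>auto intro: T_abs_le_T_exit\<close>)
  from paths have pos: "AE \<omega> in M. T_abs \<theta> c \<omega> \<noteq> 0"
    by eventually_elim (use assms(4) in \<open>simp add: T_abs_nonzero\<close>)
  have "AE \<omega> in M. inverse_powr (T_exit \<theta> d c \<omega>) p \<le> inverse_powr (T_abs \<theta> c \<omega>) p" if "p > 0" for p
    using abs_exit by eventually_elim (rule inverse_powr_antimono[OF _ that])
  thus ?thesis
    using abs_exit T_exit_le_T_one[of \<theta> d c]
      nn_integral_inverse_powr_T_abs_finite[OF assms(1-4) _ pos]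
    by (auto intro!: nn_integral_mono nn_integral_mono_AE inverse_powr_antimono)
qed

end
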